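(* Let $n,m\in\mathbb{N}$, $S\subseteq\mathbb{Z}^n$, $x(0)\in S$, and let $\mathcal{U}\subseteq\mathbb{Z}^n$ be finite. Let $G=(V,E)$ be the directed graph with $V=\mathbb{Z}^n$ and $E=\{(x,y)\mid y-x\in\mathcal{U}\}$. If there exists a finite induced subgraph $G_{\hat{S}}=(\hat{S},E_{\hat{S}})\subseteq G$ with $x(0)\in\hat{S}\subseteq S$ and $$\operatorname{mindeg}(G_{\hat{S}})\geq m\ln\left(m|\hat{S}|\right),$$ then there exists a labeling $l:E_{\hat{S}}\to[m]$ such that $G_{\hat{S}}$ and $l$ satisfy the following properties: (C1) $x(0)\in\hat{S}$; (C2) for all $x\in\hat{S}$, $l\left(\{(x,x')\in E_{\hat{S}}\mid x'\in\hat{S}\}\right)=[m]$; (C3) if $(x,y),(x',y')\in E_{\hat{S}}$ satisfy $y-x=y'-x'$, then $l(x,y)=l(x',y')$.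
   Context: Notation: $\mathbb{N}$ is the set of strictly positive integers, $[m]=\{1,\ldots,m\}$, $|\hat{S}|$ is the cardinality of $\hat{S}$. The induced subgraph $G_{\hat{S}}$ has vertex set $\hat{S}$ and edge set $E_{\hat{S}}=\{(x,y)\in E\mid x,y\in\hat{S}\}$ (loops are included if $0\in\mathcal{U}$). For a set $A$ of edges, $l(A)$ is the image of $A$ under $l$. $\operatorname{mindeg}(G_{\hat{S}})$ is the minimal outgoing degree in $G_{\hat{S}}$ of any vertex in $\hat{S}$.
   Formalization: The formal theorem also assumes mindeg(G_Ŝ) > 0; this excludes only m = 1, Ŝ = {x(0)}, 0 ∉ U, where the bound reads 0 ≥ 0 but (C2) fails as there are no edges; in all other cases it follows from the bound. *)

theory Defs
  imports
    "HOL-Analysis.Finite_Cartesian_Product"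
    "Graph_Theory.Digraph_Component"
begin

definition lattice_digraph ::
    "(int ^ 'n) set \<Rightarrow> (int ^ 'n, (int ^ 'n) \<times> (int ^ 'n)) pre_digraph" where
  "lattice_digraph \<U> =
     \<lparr> verts = UNIV, arcs = {(x, y). y - x \<in> \<U>}, tail = fst, head = snd \<rparr>"

(* Only meaningful when there are finitely many vertices, and at least one. *)
definition mindeg :: "('a, 'b) pre_digraph \<Rightarrow> nat" where
  "mindeg G = Min (out_degree G ` verts G)"

(* If every vertex emits arcs of every label in a nonempty label set, then the minimal
   out-degree is positive.  The bound mindeg \<ge> m * ln (m * card V) does not guarantee this
   when m = 1 and card V = 1: there it reads mindeg \<ge> 0, and a single vertex without a loop
   satisfies it.  In all other cases the bound is positive. *)
lemma mindeg_pos_of_labelling: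
  fixes l :: "'b \<Rightarrow> nat"
  assumes "finite (verts G)" "verts G \<noteq> {}" "finite (arcs G)" "1 \<le> m"
    and "\<forall>x\<in>verts G. l ` out_arcs G x = {1..m}"
  shows "0 < mindeg G"
proof -
  have "0 < out_degree G x" if "x \<in> verts G" for x
  proof -
    have "out_arcs G x \<noteq> {}" using assms(4,5) that by fastforce
    moreover have "finite (out_arcs G x)"
      using assms(3) by (simp add: out_arcs_def)
    ultimately show ?thesis by (simp add: out_degree_def card_gt_0_iff)
  qed
  then show ?thesis using assms(1,2) by (simp add: mindeg_def)
qed

end

(* Colour the step set \<U> uniformly at random and give each arc (x, y) the colour of y - x, so that
   (C3) holds by construction.  A vertex of out-degree at least d misses a given colour with
   probability at most (1 - 1/m)^d < exp (- d/m), and the degree bound makes the union bound over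
   all m * card Shat pairs of a vertex and a colour smaller than 1. *)
theory Submission
  imports Defs
begin

text \<open>Avoiding \<open>j\<close> on \<open>N\<close> is a condition at each point separately:
  \<open>m - 1\<close> choices on \<open>N\<close>, \<open>m\<close> choices elsewhere. Divided by
  \<open>real m ^ card U\<close>, the count is the probability that a uniform colouring misses
  \<open>j\<close> on \<open>N\<close>.\<close>

lemma card_functions_avoiding_value:
  assumes "finite U" "N \<subseteq> U" "j \<in> {1..m}"
  shows "real (card {c \<in> U \<rightarrow>\<^sub>E {1..m}. j \<notin> c ` N}) = real m ^ card U * (1 - 1 / real m) ^ card N"
proof -
  have m: "0 < m" using assms(3) by simp
  have fin: "finite N" using assms finite_subset by blast
  have "{c \<in> U \<rightarrow>\<^sub>E {1..m}. j \<notin> c ` N} = (\<Pi>\<^sub>E u\<in>U. if u \<in> N then {1..m} - {j} else {1..m})"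
    using assms(2) by (fastforce simp: PiE_iff split: if_splits)
  then have "card {c \<in> U \<rightarrow>\<^sub>E {1..m}. j \<notin> c ` N} =
      (\<Prod>u\<in>U. card (if u \<in> N then {1..m} - {j} else {1..m}))"
    using assms(1) by (simp add: card_PiE)
  \<comment> \<open>A factor \<open>m\<close> is pulled out at every point, so that
    \<open>real m ^ card U\<close> splits off; for \<open>m = 1\<close> the remaining factor on
    \<open>N\<close> is 0.\<close>
  also have "\<dots> = (\<Prod>u\<in>U. if u \<in> N then m - 1 else m)"
    using assms(3) by (intro prod.cong) auto
  also have "real \<dots> = (\<Prod>u\<in>U. real m * (if u \<in> N then 1 - 1 / real m else 1))"
    unfolding of_nat_prod using m by (intro prod.cong) (auto simp: of_nat_diff field_simps)
  also have "\<dots> = real m ^ card U * (1 - 1 / real m) ^ card N"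
    using assms(1,2) by (simp add: prod.distrib prod.If_cases Int_absorb1)
  finally show ?thesis .
qed

text \<open>The union bound as a count: the colourings that are bad for some pair of an index and a
  missed colour are fewer than all \<open>m ^ card U\<close> colourings, so a good one remains. The
  indices will be the vertices, and \<open>N i\<close> the steps available at
  \<open>i\<close>.\<close>

lemma ex_colouring_onto:
  fixes N :: "'i \<Rightarrow> 'u set"
  assumes "1 \<le> m" "finite U" "finite I"
    and N: "\<And>i. i \<in> I \<Longrightarrow> N i \<subseteq> U" "\<And>i. i \<in> I \<Longrightarrow> d \<le> card (N i)"
    and union_bound: "real m * real (card I) * (1 - 1 / real m) ^ d < 1"
  shows "\<exists>c \<in> U \<rightarrow> {1..m}. \<forall>i\<in>I. c ` N i = {1..m}"
proof -
  \<comment> \<open>Extensional functions, so that there are only finitely many colourings to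
    count.\<close>
  let ?C = "U \<rightarrow>\<^sub>E {1..m}"
  let ?B = "\<lambda>(i, j). {c \<in> ?C. j \<notin> c ` N i}"
  let ?P = "I \<times> {1..m}"
  have finC: "finite ?C" using assms(2) by (simp add: finite_PiE)
  have cardC: "real (card ?C) = real m ^ card U" using assms(2) by (simp add: card_PiE)
  have "real (card (\<Union>p\<in>?P. ?B p)) \<le> (\<Sum>p\<in>?P. real (card (?B p)))"
    using card_UN_le[of ?P ?B] assms(3) by (simp flip: of_nat_sum)
  also have "\<dots> \<le> (\<Sum>p\<in>?P. real m ^ card U * (1 - 1 / real m) ^ d)"
  proof (rule sum_mono)
    fix p assume "p \<in> ?P"
    then obtain i j where p: "p = (i, j)" "i \<in> I" "j \<in> {1..m}" by blast
    have "(1 - 1 / real m) ^ card (N i) \<le> (1 - 1 / real m) ^ d"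
      using N(2)[OF p(2)] assms(1) by (intro power_decreasing) auto
    then show "real (card (?B p)) \<le> real m ^ card U * (1 - 1 / real m) ^ d"
      using card_functions_avoiding_value[OF assms(2) N(1) p(3)] p by (simp add: mult_left_mono)
  qed
  also have "\<dots> = real m ^ card U * (real m * real (card I) * (1 - 1 / real m) ^ d)"
    by (simp add: card_cartesian_product)
  also have "\<dots> < real m ^ card U * 1"
    using union_bound assms(1) by (intro mult_strict_left_mono) auto
  finally have "card (\<Union>p\<in>?P. ?B p) < card ?C" using cardC by simp
  moreover have "finite (\<Union>p\<in>?P. ?B p)" using assms(3) finC by auto
  ultimately have "\<not> ?C \<subseteq> (\<Union>p\<in>?P. ?B p)"
    using card_mono[of "\<Union>p\<in>?P. ?B p" ?C] by (auto simp only: not_le[symmetric])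
  then obtain c where c: "c \<in> ?C" "c \<notin> (\<Union>p\<in>?P. ?B p)"
    by (meson subsetI)
  have "c ` N i = {1..m}" if "i \<in> I" for i
  proof
    show "c ` N i \<subseteq> {1..m}" using c(1) N(1)[OF that] by (auto simp: PiE_iff)
    show "{1..m} \<subseteq> c ` N i"
    proof
      fix j assume "j \<in> {1..m}"
      then have "(i, j) \<in> ?P" using that by simp
      then have "c \<notin> ?B (i, j)" using c(2) by blast
      then show "j \<in> c ` N i" using c(1) by simp
    qed
  qed
  moreover have "c \<in> U \<rightarrow> {1..m}" using c(1) by (simp add: PiE_def)
  ultimately show ?thesis by blast
qed

text \<open>The hypothesis on \<open>d\<close> is a weak inequality, so strictness must come from
  \<open>1 - 1/m < exp (- 1/m)\<close>; it survives the \<open>d\<close>-th power because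
  \<open>0 < d\<close>.\<close>

lemma union_bound_less_one:
  assumes "1 \<le> m" "0 < d" "real m * ln (real m * real k) \<le> real d"
  shows "real m * real k * (1 - 1 / real m) ^ d < 1"
\<comment> \<open>\<open>exp\<close> undoes \<open>ln\<close> only at a positive argument; for
  \<open>k = 0\<close> the product is simply 0.\<close>
proof (cases "k = 0")
  case False
  have m: "0 < real m" using assms(1) by simp
  have "1 - 1 / real m < exp (- (1 / real m))"
    using m by (simp only: exp_minus_greater) simp
  then have "(1 - 1 / real m) ^ d < exp (- (1 / real m)) ^ d"
    using assms(1,2) by (intro power_strict_mono) auto
  also have "\<dots> = exp (- (real d / real m))"
    by (simp flip: exp_of_nat_mult)
  also have "\<dots> \<le> exp (- ln (real m * real k))"
    using assms(3) m by (simp add: field_simps)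
  also have "\<dots> = 1 / (real m * real k)"
    using m False by (simp add: exp_minus inverse_eq_divide)
  finally show ?thesis using m False by (simp add: field_simps)
qed simp

text \<open>Indexing the arcs at \<open>x\<close> injectively by steps turns out-degrees into
  numbers of admissible steps, and labels of arcs into colours of steps.\<close>

lemma out_arcs_lattice_subgraph:
  assumes "x \<in> A"
  shows "out_arcs (lattice_digraph U \<restriction> A) x = (\<lambda>u. (x, x + u)) ` {u \<in> U. x + u \<in> A}"
  using assms
  by (force simp: out_arcs_def induce_subgraph_def lattice_digraph_def image_iff)

theorem theorem2:
  fixes m :: nat
    and S Shat \<U> :: "(int ^ 'n) set"
    and x0 :: "int ^ 'n"
  assumes "1 \<le> m"
    and "x0 \<in> S"
    and "finite \<U>"
    and "finite Shat" and "x0 \<in> Shat" and "Shat \<subseteq> S"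
    and "real (mindeg (lattice_digraph \<U> \<restriction> Shat)) \<ge> real m * ln (real m * real (card Shat))"
    and "0 < mindeg (lattice_digraph \<U> \<restriction> Shat)"
  shows "\<exists>l :: (int ^ 'n) \<times> (int ^ 'n) \<Rightarrow> nat.
      l \<in> arcs (lattice_digraph \<U> \<restriction> Shat) \<rightarrow> {1..m} \<and>
      x0 \<in> Shat \<and>
      (\<forall>x\<in>Shat. l ` out_arcs (lattice_digraph \<U> \<restriction> Shat) x = {1..m}) \<and>
      (\<forall>x y x' y'.
         (x, y) \<in> arcs (lattice_digraph \<U> \<restriction> Shat) \<and>
         (x', y') \<in> arcs (lattice_digraph \<U> \<restriction> Shat) \<and>
         y - x = y' - x' \<longrightarrow> l (x, y) = l (x', y'))"
proof -
  let ?G = "lattice_digraph \<U> \<restriction> Shat"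
  let ?N = "\<lambda>x. {u \<in> \<U>. x + u \<in> Shat}"
  have deg: "mindeg ?G \<le> card (?N x)" if "x \<in> Shat" for x
  proof -
    have "mindeg ?G \<le> out_degree ?G x"
      unfolding mindeg_def using assms(4) that by (intro Min_le) (auto simp: induce_subgraph_def)
    also have "\<dots> = card (?N x)"
      unfolding out_degree_def out_arcs_lattice_subgraph[OF that]
      by (intro card_image inj_onI) simp
    finally show ?thesis .
  qed
  \<comment> \<open>The index set is \<open>Shat\<close>, and the minimal degree serves as the
    common lower bound \<open>d\<close> on the number of steps.\<close>
  have "\<exists>c \<in> \<U> \<rightarrow> {1..m}. \<forall>x\<in>Shat. c ` ?N x = {1..m}"
    using assms(1,3,4) deg union_bound_less_one[OF assms(1,8,7)]
    by (intro ex_colouring_onto[where d = "mindeg ?G"]) auto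
  then obtain c where c: "c \<in> \<U> \<rightarrow> {1..m}" "\<And>x. x \<in> Shat \<Longrightarrow> c ` ?N x = {1..m}"
    by blast
  let ?l = "\<lambda>(x, y). c (y - x)"
  have "?l \<in> arcs ?G \<rightarrow> {1..m}"
    using c(1) by (auto simp: induce_subgraph_def lattice_digraph_def)
  moreover have "?l ` out_arcs ?G x = {1..m}" if "x \<in> Shat" for x
    using c(2)[OF that] by (simp add: out_arcs_lattice_subgraph[OF that] image_image)
  ultimately show ?thesis
    using assms(5) by (intro exI[of _ ?l]) auto
qed

end
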